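(* Let $a_1,\dots,a_j\in\mathbb{C}$ and $c_0,c_1,\dots,c_{j-1}\in\mathbb{C}$, and define the sequence $\{c_n\}_{n\geq 0}\subseteq\mathbb{C}$ by the recurrence relation $$c_n = a_1c_{n-1}+\cdots+a_jc_{n-j}\qquad (n\geq j).$$ For each characteristic root $r$ and nonnegative integer $k\leq j-1$, let (i) $m_r$ be the multiplicity of $r$, (ii) $s_{r,k,h}=\sum_{\ell\geq j-k}\binom{k+\ell}{h}a_{\ell}r^{-k-\ell}$ (for nonnegative integers $h$), and (iii) $N_r=(-1)^{m_r-1}\left(\sum_{\ell\geq m_r}\binom{\ell}{m_r}a_{\ell}r^{-\ell}\right)^{-1}$. Then for all $n\geq 0$, $$c_n =\sum_r\sum_{i=1}^{m_r}\kappa_{r,i}\,n^{m_r-i}r^n,$$ where the outer sum is taken over the set of characteristic roots and $$\kappa_{r,i} = \frac{(-1)^{i-1}}{(m_r-i)!}\sum_{\substack{\varnothing\neq\{d_1,\dots,d_p\}\subseteq\{0,1,\dots,i-1\}\\ d_1<\cdots<d_p=i-1}}N_r^p\left(\sum_{k_1=0}^{j-1}c_{k_1}s_{r,k_1,d_1}\right)\prod_{u=1}^{p-1}\left(\sum_{k_2=0}^{j-1}\frac{k_2^{m_r-1-d_u}\,r^{k_2}\, s_{r,k_2,d_{u+1}}}{(-1)^{d_u-1}(m_r-1-d_u)!}\right).$$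
   Context: The characteristic polynomial of the recurrence is $z^j-a_1z^{j-1}-a_2z^{j-2}-\cdots-a_{j-1}z-a_j$. A characteristic root is a complex root of this polynomial, and its multiplicity is its multiplicity as a root of this polynomial. Sums over $\ell$ with only a lower bound run over $\ell\leq j$, i.e. $a_\ell=0$ for $\ell>j$. The sum defining $\kappa_{r,i}$ ranges over all nonempty subsets of $\{0,1,\dots,i-1\}$ whose largest element is $i-1$; such a subset is written in increasing order as $d_1<\cdots<d_p$, where $p$ is its cardinality. An empty product (the case $p=1$) equals $1$, and $0^0=1$.
   Formalization: The formal theorem assumes a_j ≠ 0; if a_j = 0, then 0 is a characteristic root and s_{r,k,h} and N_r contain undefined negative powers of r = 0. *)

theory Defs
  imports Complex_Main "HOL-Computational_Algebra.Computational_Algebra"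
begin

text \<open>
  The coefficients \<open>a\<^sub>1, \<dots>, a\<^sub>j\<close> are given by a function \<open>a :: nat \<Rightarrow> complex\<close> of which only the values
  \<open>a 1, \<dots>, a j\<close> are used: sums over \<open>\<ell>\<close> stop at \<open>j\<close>.
\<close>

definition char_poly :: "nat \<Rightarrow> (nat \<Rightarrow> complex) \<Rightarrow> complex poly" where
  "char_poly j a = monom 1 j - (\<Sum>l = 1..j. monom (a l) (j - l))"

definition char_roots :: "nat \<Rightarrow> (nat \<Rightarrow> complex) \<Rightarrow> complex set" where
  "char_roots j a = {r. poly (char_poly j a) r = 0}"

definition root_mult :: "nat \<Rightarrow> (nat \<Rightarrow> complex) \<Rightarrow> complex \<Rightarrow> nat" where
  "root_mult j a r = order r (char_poly j a)"

definition s_coeff :: "nat \<Rightarrow> (nat \<Rightarrow> complex) \<Rightarrow> complex \<Rightarrow> nat \<Rightarrow> nat \<Rightarrow> complex" where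
  "s_coeff j a r k h =
     (\<Sum>l = j - k..j. of_nat ((k + l) choose h) * a l * r powi (- int k - int l))"

definition N_coeff :: "nat \<Rightarrow> (nat \<Rightarrow> complex) \<Rightarrow> complex \<Rightarrow> complex" where
  "N_coeff j a r =
     (-1) ^ (root_mult j a r - 1) *
     inverse (\<Sum>l = root_mult j a r..j. of_nat (l choose root_mult j a r) * a l * r powi (- int l))"

text \<open>
  \<open>nth_elem D u\<close> is \<open>d\<^sub>u\<close> when \<open>D = {d\<^sub>1 < \<cdots> < d\<^sub>p}\<close> is finite and \<open>1 \<le> u \<le> p\<close>; list positions
  start at 0, hence the shift.
\<close>

definition nth_elem :: "nat set \<Rightarrow> nat \<Rightarrow> nat" where
  "nth_elem D u = sorted_list_of_set D ! (u - 1)"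

definition index_sets :: "nat \<Rightarrow> nat set set" where
  "index_sets i = {D. D \<noteq> {} \<and> D \<subseteq> {0..<i} \<and> Max D = i - 1}"

text \<open>
  The exponent \<open>d\<^sub>u - 1\<close> of \<open>-1\<close> is \<open>-1\<close> when \<open>d\<^sub>u = 0\<close>, so it is taken in \<open>int\<close>. The natural-number
  subtractions do not truncate for \<open>1 \<le> i \<le> root_mult j a r\<close>: for \<open>u < p\<close> one has
  \<open>d\<^sub>u < d\<^sub>p = i - 1 \<le> root_mult j a r - 1\<close>.
\<close>

definition kappa :: "nat \<Rightarrow> (nat \<Rightarrow> complex) \<Rightarrow> (nat \<Rightarrow> complex) \<Rightarrow> complex \<Rightarrow> nat \<Rightarrow> complex" where
  "kappa j a c r i =
     (-1) ^ (i - 1) / fact (root_mult j a r - i) *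
     (\<Sum>D \<in> index_sets i.
        N_coeff j a r ^ card D *
        (\<Sum>k1 = 0..<j. c k1 * s_coeff j a r k1 (nth_elem D 1)) *
        (\<Prod>u = 1..<card D.
           \<Sum>k2 = 0..<j.
             of_nat k2 ^ (root_mult j a r - 1 - nth_elem D u) * r ^ k2 *
               s_coeff j a r k2 (nth_elem D (u + 1)) /
             ((-1) powi (int (nth_elem D u) - 1) * fact (root_mult j a r - 1 - nth_elem D u))))"

end

theory Submission
  imports Defs
begin

text \<open>
  Let \<open>Q = 1 - a\<^sub>1 x - \<dots> - a\<^sub>j x\<^sup>j\<close> be the reciprocal of the characteristic polynomial, so that
  \<open>Q = \<Prod>\<^sub>r (1 - r x)\<^bsup>m r\<^esup>\<close>, and let \<open>C\<close> be the generating function of \<open>c\<close>. Then \<open>P = Q C\<close> is a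
  polynomial of degree less than \<open>j\<close>. The whole argument rests on the meaning of the linear
  functionals \<open>S\<^sub>r\<^sub>,\<^sub>h(c) = \<Sum>\<^sub>k c\<^sub>k s\<^sub>r\<^sub>,\<^sub>k\<^sub>,\<^sub>h\<close>, summed over \<open>k < j\<close>. For \<open>h < m\<^sub>r\<close>, \<open>S\<^sub>r\<^sub>,\<^sub>h(c)\<close> is the
  coefficient of \<open>t\<^sup>h\<close> in \<open>P((1 + t) / r)\<close>: the sum over \<open>\<ell> \<ge> j - k\<close>
  collects, up to sign, the terms of degree at least \<open>j\<close> in the product of \<open>Q\<close> with the truncation of
  \<open>C\<close>; the terms of lower degree are \<open>P\<close>, and the product vanishes to order \<open>m\<^sub>r\<close> at \<open>1 / r\<close>
  (lemma \<open>s_functional_eq_coeff\<close>).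

  For \<open>q < m\<^sub>\<rho>\<close> the sequence \<open>n\<^sup>q \<rho>\<^sup>n\<close> has the generating function \<open>E / (1 - \<rho> x)\<^bsup>q + 1\<^esup>\<close> with
  \<open>E(1 / \<rho>) = q!\<close>, so its numerator is \<open>E Q / (1 - \<rho> x)\<^bsup>q + 1\<^esup>\<close>. It vanishes to order at least \<open>m\<^sub>r\<close> at \<open>1 / r\<close>
  for every root \<open>r \<noteq> \<rho>\<close>, and to order exactly \<open>m\<^sub>r - 1 - q\<close> for \<open>r = \<rho>\<close>, with leading
  coefficient in \<open>t\<close> equal to \<open>(-1)\<^bsup>m r - 1 - q\<^esup> q! / N\<^sub>r\<close>. Hence the functionals \<open>S\<^sub>r\<^sub>,\<^sub>h\<close> separate
  the roots, and for each root
  they give a triangular linear system for the coefficients of \<open>n\<^bsup>m r - i\<^esup> r\<^sup>n\<close>. Solving this system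
  by forward substitution and expanding the recursion produces one summand for each chain
  \<open>d\<^sub>1 < \<dots> < d\<^sub>p = i - 1\<close>, which is exactly the formula for \<open>\<kappa>\<^sub>r\<^sub>,\<^sub>i\<close> (lemmas \<open>chain_sum_Suc\<close> and
  \<open>kappa_triangular_system\<close>).

  The difference \<open>e\<close> between \<open>c\<close> and the claimed closed form therefore satisfies the recurrence and
  \<open>S\<^sub>r\<^sub>,\<^sub>h(e) = 0\<close> for all roots \<open>r\<close> and all \<open>h < m\<^sub>r\<close>. Its numerator has a zero of order \<open>m\<^sub>r\<close> at each
  \<open>1 / r\<close>, which makes \<open>j\<close> zeros in total for a polynomial of degree less than \<open>j\<close>; so \<open>e = 0\<close>. In this
  way the existence of a closed form, usually obtained from partial fractions or a dimension
  count, comes out together with its coefficients.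
\<close>

section \<open>The reciprocal characteristic polynomial\<close>

definition recip_char_poly :: "nat \<Rightarrow> (nat \<Rightarrow> complex) \<Rightarrow> complex poly" where
  "recip_char_poly j a = 1 - (\<Sum>l = 1..j. monom (a l) l)"

lemma coeff_recip_char_poly:
  "coeff (recip_char_poly j a) n = (if n = 0 then 1 else if n \<le> j then - a n else 0)"
  unfolding recip_char_poly_def by (auto simp: coeff_sum coeff_1)

lemma recip_char_poly_nonzero: "recip_char_poly j a \<noteq> 0"
  using coeff_recip_char_poly[of j a 0] by auto

lemma coeff_char_poly:
  "coeff (char_poly j a) n = (if n = j then 1 else if n < j then - a (j - n) else 0)"
proof -
  have "(\<Sum>l = 1..j. if j - l = n then a l else 0) = (\<Sum>l = 1..j. if l = j - n \<and> n < j then a l else 0)"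
    by (intro sum.cong) auto
  also have "\<dots> = (if n < j then a (j - n) else 0)"
    by (cases "n < j") auto
  finally show ?thesis
    unfolding char_poly_def by (auto simp: coeff_sum)
qed

lemma degree_char_poly: "degree (char_poly j a) = j"
  by (rule antisym) (auto intro: degree_le le_degree simp: coeff_char_poly)

lemma char_poly_nonzero: "char_poly j a \<noteq> 0"
  using coeff_char_poly[of j a j] by auto

lemma finite_char_roots: "finite (char_roots j a)"
  unfolding char_roots_def by (rule poly_roots_finite[OF char_poly_nonzero])

lemma reflect_char_poly: "reflect_poly (char_poly j a) = recip_char_poly j a"
  by (rule poly_eqI)
    (auto simp: coeff_reflect_poly degree_char_poly coeff_char_poly coeff_recip_char_poly)

lemma char_root_nonzero:
  assumes "j \<ge> 1" "a j \<noteq> 0" "r \<in> char_roots j a"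
  shows "r \<noteq> 0"
proof
  assume "r = 0"
  then have "coeff (char_poly j a) 0 = 0"
    using assms(3) by (simp add: char_roots_def poly_0_coeff_0)
  then show False using assms(1,2) by (auto simp: coeff_char_poly)
qed

lemma root_mult_pos:
  assumes "r \<in> char_roots j a"
  shows "0 < root_mult j a r"
  using assms char_poly_nonzero order_root[of "char_poly j a" r]
  unfolding char_roots_def root_mult_def by auto

lemma reflect_linear: "r \<noteq> 0 \<Longrightarrow> reflect_poly [:- r, 1:] = [:1, - r :: complex:]"
  by (simp add: reflect_poly_def)

text \<open>
  Since the characteristic roots are nonzero, reversing coefficients turns each factor \<open>x - r\<close> of
  the characteristic polynomial into \<open>1 - r x\<close>.
\<close>

lemma recip_char_poly_factorization:
  assumes "j \<ge> 1" "a j \<noteq> 0"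
  shows "recip_char_poly j a = (\<Prod>r\<in>char_roots j a. [:1, - r:] ^ root_mult j a r)"
proof -
  have "char_poly j a = (\<Prod>r\<in>char_roots j a. [:- r, 1:] ^ root_mult j a r)"
    using complex_poly_decompose[of "char_poly j a"]
    by (simp add: degree_char_poly coeff_char_poly char_roots_def root_mult_def)
  then have "recip_char_poly j a = reflect_poly (\<Prod>r\<in>char_roots j a. [:- r, 1:] ^ root_mult j a r)"
    using reflect_char_poly[of j a] by simp
  also have "\<dots> = (\<Prod>r\<in>char_roots j a. reflect_poly [:- r, 1:] ^ root_mult j a r)"
    by (simp add: reflect_poly_prod reflect_poly_power)
  also have "\<dots> = (\<Prod>r\<in>char_roots j a. [:1, - r:] ^ root_mult j a r)"
    using char_root_nonzero[of j a] assms by (intro prod.cong) (auto simp: reflect_linear)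
  finally show ?thesis .
qed

definition cofactor :: "nat \<Rightarrow> (nat \<Rightarrow> complex) \<Rightarrow> complex \<Rightarrow> complex poly" where
  "cofactor j a r = (\<Prod>s\<in>char_roots j a - {r}. [:1, - s:] ^ root_mult j a s)"

lemma recip_char_poly_cofactor:
  assumes "j \<ge> 1" "a j \<noteq> 0" "r \<in> char_roots j a"
  shows "recip_char_poly j a = [:1, - r:] ^ root_mult j a r * cofactor j a r"
  using assms finite_char_roots
  by (simp add: recip_char_poly_factorization cofactor_def prod.remove)

lemma cofactor_nonzero_at_inverse:
  assumes "r \<noteq> 0"
  shows "poly (cofactor j a r) (inverse r) \<noteq> 0"
  using assms finite_char_roots
  by (auto simp: cofactor_def poly_prod field_simps)

lemma degree_recip_char_poly:
  assumes "j \<ge> 1" "a j \<noteq> 0"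
  shows "degree (recip_char_poly j a) = j"
  by (rule antisym) (use assms in \<open>auto intro: degree_le le_degree simp: coeff_recip_char_poly\<close>)

section \<open>Numerators of generating functions\<close>

text \<open>
  The truncation makes \<open>numerator\<close> defined, and linear, on all sequences. For a solution of the
  recurrence nothing is cut off and it is the numerator of the rational function \<open>C = P / Q\<close>.
\<close>

definition numerator :: "nat \<Rightarrow> (nat \<Rightarrow> complex) \<Rightarrow> (nat \<Rightarrow> complex) \<Rightarrow> complex poly" where
  "numerator j a c =
     (\<Sum>n<j. monom (fps_nth (fps_of_poly (recip_char_poly j a) * Abs_fps c) n) n)"

lemma coeff_numerator:
  "coeff (numerator j a c) n =
     (if n < j then fps_nth (fps_of_poly (recip_char_poly j a) * Abs_fps c) n else 0)"
  by (auto simp: numerator_def coeff_sum)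

lemma recip_char_poly_times_gf:
  "fps_nth (fps_of_poly (recip_char_poly j a) * Abs_fps c) n =
     c n - (\<Sum>l = 1..min j n. a l * c (n - l))"
proof -
  have "fps_nth (fps_of_poly (recip_char_poly j a) * Abs_fps c) n
      = (\<Sum>l = 0..n. coeff (recip_char_poly j a) l * c (n - l))"
    by (simp add: fps_mult_nth)
  also have "\<dots> = c n + (\<Sum>l = 1..n. coeff (recip_char_poly j a) l * c (n - l))"
    by (simp add: sum.atLeast_Suc_atMost coeff_recip_char_poly)
  also have "(\<Sum>l = 1..n. coeff (recip_char_poly j a) l * c (n - l))
      = (\<Sum>l = 1..min j n. - a l * c (n - l))"
    by (rule sum.mono_neutral_cong_right) (auto simp: coeff_recip_char_poly)
  finally show ?thesis by (simp add: sum_negf)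
qed

lemma numerator_eqI:
  assumes "fps_of_poly (recip_char_poly j a) * Abs_fps c = fps_of_poly P" "degree P < j"
  shows "numerator j a c = P"
  by (rule poly_eqI) (use assms in \<open>auto simp: coeff_numerator coeff_eq_0\<close>)

lemma degree_numerator: "j \<ge> 1 \<Longrightarrow> degree (numerator j a c) < j"
  by (rule degree_lessI) (auto simp: coeff_numerator)

section \<open>Taylor coefficients at a reciprocal root\<close>

text \<open>
  The coefficients of \<open>recenter r p\<close> are those of \<open>p((1 + t) / r)\<close> as a polynomial in \<open>t\<close>. Scaling \<open>t\<close> by
  \<open>1 / r\<close> turns \<open>1 - r x\<close> into \<open>- t\<close> and sends \<open>x\<^sup>n\<close> to \<open>\<Sum>\<^sub>h (n choose h) r\<^bsup>- n\<^esup> t\<^sup>h\<close>, the shape of the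
  summands of \<open>s_coeff\<close> and \<open>N_coeff\<close>.
\<close>

abbreviation recenter :: "complex \<Rightarrow> complex poly \<Rightarrow> complex poly" where
  "recenter r p \<equiv> pcompose p [:inverse r, inverse r:]"

lemma recenter_linear: "r \<noteq> 0 \<Longrightarrow> recenter r [:1, - r:] = [:0, - 1:]"
  by (simp add: pcompose_pCons)

lemma pcompose_power: "pcompose (p ^ n) q = pcompose p q ^ n" for p q :: "complex poly"
  by (induction n) (simp_all add: pcompose_mult pcompose_1)

lemma coeff_recenter_monom:
  "coeff (recenter r (monom b n)) h = b * of_nat (n choose h) * inverse r ^ n"
proof -
  have "recenter r (monom b n) = smult (b * inverse r ^ n) ([:1, 1:] ^ n)"
  proof -
    have "recenter r (monom 1 n) = [:inverse r, inverse r:] ^ n"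
      by (simp add: monom_altdef pcompose_power pcompose_pCons)
    also have "\<dots> = (smult (inverse r) [:1, 1:]) ^ n" by simp
    finally have "recenter r (monom 1 n) = smult (inverse r ^ n) ([:1, 1:] ^ n)"
      by (simp only: smult_power)
    moreover have "monom b n = smult b (monom 1 n)" by (simp add: smult_monom)
    ultimately show ?thesis by (simp add: pcompose_smult)
  qed
  then show ?thesis
    by (cases "h \<le> n") (simp_all add: coeff_linear_poly_power coeff_eq_0 degree_linear_power binomial_eq_0)
qed

lemma minus_X_power: "[:0, - 1 :: complex:] ^ m = smult ((- 1) ^ m) (monom 1 m)"
proof -
  have "[:0, - 1 :: complex:] = smult (- 1) [:0, 1:]" by simp
  then show ?thesis by (simp only: smult_power monom_altdef smult_1_left)
qed

lemma coeff_minus_X_power_mult_low: "h < m \<Longrightarrow> coeff ([:0, - 1 :: complex:] ^ m * p) h = 0"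
  by (simp add: minus_X_power coeff_monom_mult)

lemma coeff_minus_X_power_mult_lead: "coeff ([:0, - 1 :: complex:] ^ m * p) m = (- 1) ^ m * coeff p 0"
  by (simp add: minus_X_power coeff_monom_mult)

lemma coeff_0_recenter: "coeff (recenter r p) 0 = poly p (inverse r)"
  by (simp add: poly_0_coeff_0[symmetric] poly_pcompose)

text \<open>
  The sum in \<open>N_coeff\<close> is minus the leading Taylor coefficient of \<open>Q\<close> at \<open>1 / r\<close>, and
  \<open>Q((1 + t) / r) = (- t)\<^sup>m U((1 + t) / r)\<close> for the cofactor \<open>U\<close> of \<open>(1 - r x)\<^sup>m\<close>; the sign
  \<open>(-1)\<^bsup>m - 1\<^esup>\<close> in \<open>N_coeff\<close> cancels the sign that results.
\<close>

lemma N_coeff_eq: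
  assumes "j \<ge> 1" "a j \<noteq> 0" "r \<in> char_roots j a"
  shows "N_coeff j a r = inverse (poly (cofactor j a r) (inverse r))"
proof -
  define m where "m = root_mult j a r"
  have r: "r \<noteq> 0" and m: "m > 0"
    using assms char_root_nonzero root_mult_pos unfolding m_def by auto
  have pw: "r powi (- int l) = inverse r ^ l" for l
    by (simp add: power_int_minus power_inverse)
  have "coeff (recenter r (recip_char_poly j a)) m
      = - (\<Sum>l = 1..j. a l * of_nat (l choose m) * inverse r ^ l)"
    using m by (simp add: recip_char_poly_def pcompose_diff pcompose_sum coeff_sum
        coeff_recenter_monom coeff_1 pcompose_1)
  also have "(\<Sum>l = 1..j. a l * of_nat (l choose m) * inverse r ^ l)
      = (\<Sum>l = m..j. of_nat (l choose m) * a l * r powi (- int l))"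
    using m unfolding pw by (intro sum.mono_neutral_cong_right) (auto simp: binomial_eq_0)
  finally have 1: "coeff (recenter r (recip_char_poly j a)) m
      = - (\<Sum>l = m..j. of_nat (l choose m) * a l * r powi (- int l))" .
  have "recenter r (recip_char_poly j a) = [:0, - 1:] ^ m * recenter r (cofactor j a r)"
    using recip_char_poly_cofactor[OF assms] r
    by (simp add: pcompose_mult pcompose_power recenter_linear m_def[symmetric] del: power_Suc)
  then have 2: "coeff (recenter r (recip_char_poly j a)) m
      = (- 1) ^ m * poly (cofactor j a r) (inverse r)"
    by (simp only: coeff_minus_X_power_mult_lead coeff_0_recenter)
  from m obtain m' where m': "m = Suc m'" by (cases m) auto
  have "(\<Sum>l = m..j. of_nat (l choose m) * a l * r powi (- int l))
      = (- 1) ^ (m - 1) * poly (cofactor j a r) (inverse r)"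
    using 1 2 by (simp add: m')
  then show ?thesis
    unfolding N_coeff_def m_def[symmetric] by (simp add: power_inverse[symmetric])
qed

text \<open>
  Let \<open>T\<close> be the truncation of the generating function of \<open>c\<close> to degree below \<open>j\<close>. In \<open>T Q\<close> the terms
  \<open>- c\<^sub>k a\<^sub>\<ell> x\<^bsup>k + \<ell>\<^esup>\<close> of degree at least \<open>j\<close> are those with \<open>\<ell> \<ge> j - k\<close>; removing them leaves the
  numerator \<open>P\<close>. Thus \<open>P = T Q + G\<close> with \<open>G\<close> the sum of the \<open>c\<^sub>k a\<^sub>\<ell> x\<^bsup>k + \<ell>\<^esup>\<close> over these pairs. As \<open>Q\<close> vanishes
  to order \<open>m\<^sub>r\<close> at \<open>1 / r\<close>, the polynomials \<open>P\<close> and \<open>G\<close> have the same Taylor coefficients there below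
  order \<open>m\<^sub>r\<close>, and those of \<open>G\<close> are the functionals in question.
\<close>

lemma s_functional_eq_coeff:
  assumes "j \<ge> 1" "a j \<noteq> 0" "r \<in> char_roots j a" "h < root_mult j a r"
  shows "(\<Sum>k = 0..<j. c k * s_coeff j a r k h) = coeff (recenter r (numerator j a c)) h"
proof -
  define m where "m = root_mult j a r"
  have r: "r \<noteq> 0" using assms char_root_nonzero by auto
  define Q where "Q = recip_char_poly j a"
  define T where "T = (\<Sum>k<j. monom (c k) k)"
  define G where "G = (\<Sum>k<j. \<Sum>l = j - k..j. monom (c k * a l) (k + l))"
  have coeff_T: "coeff T n = (if n < j then c n else 0)" for n
    by (auto simp: T_def coeff_sum)
  have G_low: "coeff G n = 0" if "n < j" for n
    using that by (auto simp: G_def coeff_sum intro!: sum.neutral)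
  have split: "{1..j} = {1..<j - k} \<union> {j - k..j}" if "k < j" for k
    using that by auto
  have "T * Q = T - (\<Sum>k<j. \<Sum>l = 1..j. monom (c k * a l) (k + l))"
    unfolding T_def Q_def recip_char_poly_def
    by (subst sum.swap)
      (simp add: algebra_simps sum_distrib_left sum_distrib_right mult_monom)
  also have "(\<Sum>k<j. \<Sum>l = 1..j. monom (c k * a l) (k + l))
     = (\<Sum>k<j. (\<Sum>l = 1..<j - k. monom (c k * a l) (k + l)) + (\<Sum>l = j - k..j. monom (c k * a l) (k + l)))"
  proof (rule sum.cong)
    fix k assume "k \<in> {..<j}"
    then show "(\<Sum>l = 1..j. monom (c k * a l) (k + l)) =
      (\<Sum>l = 1..<j - k. monom (c k * a l) (k + l)) + (\<Sum>l = j - k..j. monom (c k * a l) (k + l))"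
      unfolding split[of k, simplified, OF \<open>k \<in> {..<j}\<close>[simplified]]
      by (subst sum.union_disjoint[symmetric]) (auto intro!: sum.cong)
  qed simp
  also have "\<dots> = (\<Sum>k<j. \<Sum>l = 1..<j - k. monom (c k * a l) (k + l)) + G"
    by (simp add: G_def sum.distrib)
  finally have TQ: "T * Q + G = T - (\<Sum>k<j. \<Sum>l = 1..<j - k. monom (c k * a l) (k + l))"
    by simp
  have "numerator j a c = T * Q + G"
  proof (rule poly_eqI)
    fix n
    show "coeff (numerator j a c) n = coeff (T * Q + G) n"
    proof (cases "n < j")
      case True
      have "coeff (T * Q + G) n = (\<Sum>i\<le>n. coeff Q i * coeff T (n - i))"
        using True by (simp add: G_low mult.commute[of T] coeff_mult)
      also have "\<dots> = (\<Sum>i = 0..n. coeff Q i * c (n - i))"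
        using True by (intro sum.cong) (auto simp: coeff_T)
      finally show ?thesis
        using True by (simp add: coeff_numerator fps_mult_nth Q_def)
    next
      case False
      then have "coeff (T * Q + G) n = 0"
        unfolding TQ by (auto simp: coeff_T coeff_sum intro!: sum.neutral)
      then show ?thesis using False by (simp add: coeff_numerator)
    qed
  qed
  moreover have "Q = [:1, - r:] ^ m * cofactor j a r"
    using recip_char_poly_cofactor[OF assms(1-3)] by (simp add: Q_def m_def)
  ultimately have "recenter r (numerator j a c)
      = [:0, - 1:] ^ m * (recenter r (T * cofactor j a r)) + recenter r G"
    using r by (simp add: pcompose_add pcompose_mult pcompose_power recenter_linear mult_ac)
  then have "coeff (recenter r (numerator j a c)) h = coeff (recenter r G) h"
    using assms(4) by (simp only: coeff_add coeff_minus_X_power_mult_low m_def) simp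
  also have "\<dots> = (\<Sum>k<j. \<Sum>l = j - k..j. c k * a l * of_nat ((k + l) choose h) * inverse r ^ (k + l))"
    by (simp add: G_def pcompose_sum coeff_sum coeff_recenter_monom)
  also have "\<dots> = (\<Sum>k = 0..<j. c k * s_coeff j a r k h)"
  proof -
    have "r powi (- int k - int l) = inverse r ^ (k + l)" for k l
    proof -
      have "- int k - int l = - int (k + l)" by simp
      then show ?thesis by (simp only: power_int_minus power_int_of_nat power_inverse)
    qed
    then show ?thesis
      unfolding s_coeff_def by (simp add: atLeast0LessThan sum_distrib_left mult_ac)
  qed
  finally show ?thesis by simp
qed

section \<open>The sequences \<open>n\<^sup>q r\<^sup>n\<close>\<close>

text \<open>
  Multiplying the \<open>n\<close>-th term by \<open>n\<close> is the operator \<open>x d/dx\<close> on generating functions. Applied to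
  \<open>E / (1 - r x)\<^bsup>q + 1\<^esup>\<close> it gives the next numerator \<open>x ((1 - r x) E' + (q + 1) r E)\<close> (for \<open>r = 1\<close>
  these are \<open>x\<close> times the Eulerian polynomials, except at \<open>q = 0\<close>), whose value at \<open>1 / r\<close> is
  \<open>(q + 1) E(1 / r)\<close>.
\<close>

lemma gf_power_times_geometric:
  fixes r :: complex
  assumes "r \<noteq> 0"
  shows "\<exists>E. degree E \<le> q \<and> poly E (inverse r) = fact q \<and>
    fps_of_poly ([:1, - r:] ^ Suc q) * Abs_fps (\<lambda>n. of_nat n ^ q * r ^ n) = fps_of_poly E"
proof (induction q)
  case 0
  have "fps_of_poly [:1, - r:] * Abs_fps (\<lambda>n. r ^ n) = 1"
  proof (rule fps_ext)
    fix n
    show "fps_nth (fps_of_poly [:1, - r:] * Abs_fps (\<lambda>n. r ^ n)) n = fps_nth 1 n"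
      by (cases n) (auto simp: fps_of_poly_pCons algebra_simps fps_mult_right_const_nth)
  qed
  then show ?case by (intro exI[of _ 1]) simp
next
  case (Suc q)
  define L where "L = [:1, - r:]"
  define F where "F = Abs_fps (\<lambda>n. of_nat n ^ q * r ^ n)"
  obtain E where E: "degree E \<le> q" "poly E (inverse r) = fact q"
    "fps_of_poly (L ^ Suc q) * F = fps_of_poly E"
    using Suc unfolding L_def F_def by blast
  define k where "k = of_nat (Suc q) * r"
  define E' where "E' = [:0, 1:] * (L * pderiv E + smult k E)"
  have XF: "fps_X * fps_deriv F = Abs_fps (\<lambda>n. of_nat n ^ Suc q * r ^ n)"
    by (rule fps_ext) (auto simp: F_def)
  have "pderiv L = [:- r:]" by (simp add: L_def pderiv_pCons)
  then have dL: "pderiv (L ^ Suc q) = smult (- k) (L ^ q)"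
    by (simp only: pderiv_power_Suc k_def) (simp add: mult.commute del: of_nat_Suc)
  have "fps_of_poly (L * pderiv E) = fps_of_poly L * fps_deriv (fps_of_poly (L ^ Suc q) * F)"
    by (simp only: fps_of_poly_mult fps_of_poly_pderiv E(3))
  also have "\<dots> = fps_of_poly (L ^ Suc (Suc q)) * fps_deriv F
      - fps_const k * (fps_of_poly (L ^ Suc q) * F)"
    unfolding fps_deriv_mult fps_of_poly_pderiv[symmetric] dL
    by (simp add: fps_of_poly_mult fps_of_poly_smult fps_of_poly_uminus algebra_simps flip: fps_const_neg)
  finally have "fps_of_poly (L ^ Suc (Suc q)) * fps_deriv F = fps_of_poly (L * pderiv E + smult k E)"
    by (simp only: E(3) fps_of_poly_add fps_of_poly_smult) simp
  then have "fps_of_poly (L ^ Suc (Suc q)) * (fps_X * fps_deriv F) = fps_of_poly E'"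
    unfolding E'_def by (simp only: fps_of_poly_mult mult.left_commute[of _ fps_X]) simp
  moreover have "poly E' (inverse r) = fact (Suc q)"
    using assms E(2) by (simp add: E'_def L_def k_def field_simps)
  moreover have "degree E' \<le> Suc q"
  proof -
    have "degree (L * pderiv E) \<le> q"
    proof (cases "pderiv E = 0")
      case False
      then have "degree E > 0" by (simp add: pderiv_eq_0_iff)
      then show ?thesis
        using E(1) degree_mult_le[of L "pderiv E"] False
        by (simp add: L_def degree_pderiv split: if_splits)
    qed simp
    then have "degree (L * pderiv E + smult k E) \<le> q"
      using E(1) by (intro degree_add_le) (auto intro: order_trans[OF degree_smult_le])
    then show ?thesis
      using degree_mult_le[of "[:0, 1:]" "L * pderiv E + smult k E"]
      by (simp add: E'_def del: of_nat_Suc mult_pCons_left mult_pCons_right)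
  qed
  ultimately show ?case
    unfolding XF L_def by blast
qed

text \<open>
  Cancelling \<open>(1 - r x)\<^bsup>q + 1\<^esup>\<close> against \<open>Q\<close> leaves a polynomial of degree less than \<open>j\<close>. This shows at
  once that \<open>n\<^sup>q r\<^sup>n\<close> solves the recurrence and what its numerator is.
\<close>

lemma basic_solution:
  assumes "j \<ge> 1" "a j \<noteq> 0" "r \<in> char_roots j a" "q < root_mult j a r"
  shows "\<exists>E. poly E (inverse r) = fact q \<and>
    numerator j a (\<lambda>n. of_nat n ^ q * r ^ n)
      = [:1, - r:] ^ (root_mult j a r - 1 - q) * (cofactor j a r * E) \<and>
    fps_of_poly (recip_char_poly j a) * Abs_fps (\<lambda>n. of_nat n ^ q * r ^ n)
      = fps_of_poly (numerator j a (\<lambda>n. of_nat n ^ q * r ^ n))"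
proof -
  define m where "m = root_mult j a r"
  define U where "U = cofactor j a r"
  define F where "F = Abs_fps (\<lambda>n. of_nat n ^ q * r ^ n)"
  define L where "L = [:1, - r:]"
  have r: "r \<noteq> 0" using assms char_root_nonzero by auto
  then have L: "L \<noteq> 0" "degree L = 1" by (auto simp: L_def)
  obtain E where E: "degree E \<le> q" "poly E (inverse r) = fact q"
    "fps_of_poly (L ^ Suc q) * F = fps_of_poly E"
    using gf_power_times_geometric[OF r, of q] unfolding F_def L_def by blast
  define P where "P = L ^ (m - 1 - q) * (U * E)"
  have "m = (m - 1 - q) + Suc q" using assms(4) by (simp add: m_def)
  then have "L ^ m = L ^ (m - 1 - q) * L ^ Suc q" by (metis power_add)
  moreover have "recip_char_poly j a = L ^ m * U"
    unfolding m_def L_def U_def by (rule recip_char_poly_cofactor[OF assms(1-3)])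
  ultimately have Q: "recip_char_poly j a = (L ^ (m - 1 - q) * U) * L ^ Suc q"
    by (simp only: mult_ac)
  have "fps_of_poly (recip_char_poly j a) * F
      = fps_of_poly (L ^ (m - 1 - q) * U) * (fps_of_poly (L ^ Suc q) * F)"
    unfolding Q fps_of_poly_mult[of _ "L ^ Suc q"] by (rule mult.assoc)
  also have "\<dots> = fps_of_poly P"
    unfolding E(3) P_def by (simp only: fps_of_poly_mult mult.assoc)
  finally have eq: "fps_of_poly (recip_char_poly j a) * F = fps_of_poly P" .
  have "degree P < j"
  proof -
    have "U \<noteq> 0" using cofactor_nonzero_at_inverse[OF r, of j a] by (auto simp: U_def)
    then have "degree ((L ^ (m - 1 - q) * U) * L ^ Suc q) = degree (L ^ (m - 1 - q) * U) + Suc q"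
      using L by (simp add: degree_mult_eq degree_power_eq del: power_Suc)
    then have "j = degree (L ^ (m - 1 - q) * U) + Suc q"
      using degree_recip_char_poly[of j a, OF assms(1,2)] unfolding Q by simp
    moreover have "degree P \<le> degree (L ^ (m - 1 - q) * U) + degree E"
      unfolding P_def mult.assoc[symmetric] by (rule degree_mult_le)
    ultimately show ?thesis using E(1) by linarith
  qed
  then have P: "numerator j a (\<lambda>n. of_nat n ^ q * r ^ n) = P"
    by (rule numerator_eqI[OF eq[unfolded F_def]])
  show ?thesis
    by (rule exI[of _ E], unfold P)
      (use E(2) eq in \<open>simp add: P_def F_def L_def U_def m_def\<close>)
qed

text \<open>
  The factor \<open>(1 - r x)\<^bsup>m r\<^esup>\<close> of \<open>Q\<close> survives in the numerator of \<open>n\<^sup>q r'\<^sup>n\<close>.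
\<close>

lemma s_functional_other_root:
  assumes "j \<ge> 1" "a j \<noteq> 0" "r \<in> char_roots j a" "r' \<in> char_roots j a" "r \<noteq> r'"
    "q < root_mult j a r'" "h < root_mult j a r"
  shows "(\<Sum>k = 0..<j. of_nat k ^ q * r' ^ k * s_coeff j a r k h) = 0"
proof -
  have r: "r \<noteq> 0" using assms char_root_nonzero by auto
  obtain E where E: "numerator j a (\<lambda>n. of_nat n ^ q * r' ^ n)
      = [:1, - r':] ^ (root_mult j a r' - 1 - q) * (cofactor j a r' * E)"
    using basic_solution[OF assms(1,2,4,6)] by blast
  have "[:1, - r:] ^ root_mult j a r dvd cofactor j a r'"
    unfolding cofactor_def
    by (rule dvd_prodI[where f = "\<lambda>s. [:1, - s:] ^ root_mult j a s"]) (use assms finite_char_roots in auto)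
  then have "[:1, - r:] ^ root_mult j a r dvd numerator j a (\<lambda>n. of_nat n ^ q * r' ^ n)"
    unfolding E by simp
  then obtain V where "numerator j a (\<lambda>n. of_nat n ^ q * r' ^ n) = [:1, - r:] ^ root_mult j a r * V"
    by (auto elim: dvdE)
  then have "recenter r (numerator j a (\<lambda>n. of_nat n ^ q * r' ^ n))
      = [:0, - 1:] ^ root_mult j a r * recenter r V"
    using r by (simp add: pcompose_mult pcompose_power recenter_linear)
  then show ?thesis
    using assms(7) by (simp add: s_functional_eq_coeff[OF assms(1-3,7)] coeff_minus_X_power_mult_low)
qed

text \<open>
  The numerator of \<open>n\<^sup>q r\<^sup>n\<close> is \<open>(1 - r x)\<^bsup>m - 1 - q\<^esup>\<close> times a polynomial with value \<open>q! / N\<^sub>r\<close> at \<open>1 / r\<close>.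
  This is what makes the linear system for the coefficients triangular, with known diagonal.
\<close>

lemma s_functional_same_root:
  assumes "j \<ge> 1" "a j \<noteq> 0" "r \<in> char_roots j a" "q < root_mult j a r" "h < root_mult j a r"
  shows "h + q < root_mult j a r - 1 \<Longrightarrow>
      (\<Sum>k = 0..<j. of_nat k ^ q * r ^ k * s_coeff j a r k h) = 0"
    and "h + q = root_mult j a r - 1 \<Longrightarrow>
      (\<Sum>k = 0..<j. of_nat k ^ q * r ^ k * s_coeff j a r k h)
        = (- 1) ^ h * fact q * inverse (N_coeff j a r)"
proof -
  have r: "r \<noteq> 0" using assms char_root_nonzero by auto
  obtain E where E: "poly E (inverse r) = fact q" "numerator j a (\<lambda>n. of_nat n ^ q * r ^ n)
      = [:1, - r:] ^ (root_mult j a r - 1 - q) * (cofactor j a r * E)"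
    using basic_solution[OF assms(1-4)] by blast
  have *: "recenter r (numerator j a (\<lambda>n. of_nat n ^ q * r ^ n))
      = [:0, - 1:] ^ (root_mult j a r - 1 - q) * recenter r (cofactor j a r * E)"
    using r unfolding E(2) by (simp add: pcompose_mult pcompose_power recenter_linear)
  show "(\<Sum>k = 0..<j. of_nat k ^ q * r ^ k * s_coeff j a r k h) = 0"
    if "h + q < root_mult j a r - 1"
    using that unfolding s_functional_eq_coeff[OF assms(1-3,5)] *
    by (intro coeff_minus_X_power_mult_low) simp
  show "(\<Sum>k = 0..<j. of_nat k ^ q * r ^ k * s_coeff j a r k h)
        = (- 1) ^ h * fact q * inverse (N_coeff j a r)"
    if "h + q = root_mult j a r - 1"
  proof -
    have h: "root_mult j a r - 1 - q = h" using that by simp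
    show ?thesis
      unfolding s_functional_eq_coeff[OF assms(1-3,5)] * h coeff_minus_X_power_mult_lead coeff_0_recenter
      by (simp add: E(1) N_coeff_eq[OF assms(1-3)])
  qed
qed

section \<open>Sums over chains\<close>

text \<open>
  The sum in \<open>kappa\<close> with its factors made abstract: \<open>f\<close> is the weight of the first element \<open>d\<^sub>1\<close> of a
  chain \<open>d\<^sub>1 < \<dots> < d\<^sub>p\<close>, and \<open>g\<close> the weight of a step from \<open>d\<^sub>u\<close> to \<open>d\<^bsub>u + 1\<^esub>\<close>.
\<close>

definition chain_sum ::
  "complex \<Rightarrow> (nat \<Rightarrow> complex) \<Rightarrow> (nat \<Rightarrow> nat \<Rightarrow> complex) \<Rightarrow> nat \<Rightarrow> complex" where
  "chain_sum N f g i = (\<Sum>D\<in>index_sets i. N ^ card D * f (nth_elem D 1) *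
     (\<Prod>u = 1..<card D. g (nth_elem D u) (nth_elem D (u + 1))))"

lemma finite_index_sets: "finite (index_sets i)"
  by (rule finite_subset[of _ "Pow {0..<i}"]) (auto simp: index_sets_def)

lemma index_setsD:
  assumes "D \<in> index_sets (Suc d)"
  shows "finite D" "D \<noteq> {}" "d \<in> D" "\<And>x. x \<in> D \<Longrightarrow> x \<le> d" "Max D = d"
proof -
  show fin: "finite D" using assms finite_subset[of D "{0..<Suc d}"] by (auto simp: index_sets_def)
  show ne: "D \<noteq> {}" and M: "Max D = d" using assms by (auto simp: index_sets_def)
  show "d \<in> D" using Max_in[OF fin ne] M by simp
  show "\<And>x. x \<in> D \<Longrightarrow> x \<le> d" using Max_ge[OF fin] M by auto
qed

lemma index_setsI:
  assumes "d \<in> D" "\<And>x. x \<in> D \<Longrightarrow> x \<le> d"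
  shows "D \<in> index_sets (Suc d)"
proof -
  have sub: "D \<subseteq> {0..<Suc d}" using assms(2) by (auto simp: less_Suc_eq_le)
  then have "finite D" by (rule finite_subset) simp
  then have "Max D = d" using assms by (intro Max_eqI) auto
  then show ?thesis using assms sub by (auto simp: index_sets_def)
qed

text \<open>
  Removing the largest element \<open>h\<close> of a chain with at least two elements leaves a chain with largest
  element \<open>d < h\<close>.
\<close>

lemma index_sets_Suc:
  "index_sets (Suc h) = insert {h} (\<Union>d<h. insert h ` index_sets (Suc d))"
proof (intro equalityI subsetI)
  fix D assume D: "D \<in> index_sets (Suc h)"
  note D' = index_setsD[OF D]
  show "D \<in> insert {h} (\<Union>d<h. insert h ` index_sets (Suc d))"
  proof (cases "D = {h}")
    case False
    define B where "B = D - {h}"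
    have B: "finite B" "B \<noteq> {}" "D = insert h B" using D' False by (auto simp: B_def)
    then have "Max B \<in> B" by simp
    then have lt: "Max B < h" using D'(4)[of "Max B"] by (auto simp: B_def)
    have "B \<in> index_sets (Suc (Max B))"
      using B by (intro index_setsI) auto
    then show ?thesis using lt B(3) by blast
  qed simp
next
  fix D assume "D \<in> insert {h} (\<Union>d<h. insert h ` index_sets (Suc d))"
  then show "D \<in> index_sets (Suc h)"
    by (auto intro!: index_setsI dest!: index_setsD(4) elim: order_trans)
qed

lemma nth_elem_insert_Max:
  assumes "finite D" "\<And>x. x \<in> D \<Longrightarrow> x < h"
  shows "1 \<le> u \<Longrightarrow> u \<le> card D \<Longrightarrow> nth_elem (insert h D) u = nth_elem D u"
    and "nth_elem (insert h D) (Suc (card D)) = h"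
proof -
  have *: "sorted_list_of_set (insert h D) = sorted_list_of_set D @ [h]"
    using assms
    by (intro sorted_distinct_set_unique)
      (auto simp: sorted_append less_imp_le simp del: sorted_list_of_set_insert_remove)
  show "1 \<le> u \<Longrightarrow> u \<le> card D \<Longrightarrow> nth_elem (insert h D) u = nth_elem D u"
    "nth_elem (insert h D) (Suc (card D)) = h"
    by (auto simp: nth_elem_def * nth_append)
qed

lemma nth_elem_card:
  assumes "D \<in> index_sets (Suc d)"
  shows "nth_elem D (card D) = d"
proof -
  note D = index_setsD[OF assms]
  have "D = insert d (D - {d})" using D by auto
  moreover have "card D = Suc (card (D - {d}))" using D by (metis card_Suc_Diff1)
  moreover have "nth_elem (insert d (D - {d})) (Suc (card (D - {d}))) = d"
    using D by (intro nth_elem_insert_Max) (auto simp: le_neq_implies_less)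
  ultimately show ?thesis by simp
qed

text \<open>
  This recursion on the last element of the chain is the forward substitution in the triangular
  system \<open>x\<^sub>h = N (f h + (\<Sum>d<h. x\<^sub>d g d h))\<close>, so chain sums are its solutions.
\<close>

lemma chain_sum_Suc:
  "chain_sum N f g (Suc h) = N * (f h + (\<Sum>d<h. chain_sum N f g (Suc d) * g d h))"
proof -
  define w where "w D = N ^ card D * f (nth_elem D 1) *
     (\<Prod>u = 1..<card D. g (nth_elem D u) (nth_elem D (u + 1)))" for D
  have w_insert: "w (insert h D) = N * w D * g d h" if "D \<in> index_sets (Suc d)" "d < h" for d D
  proof -
    note D = index_setsD[OF that(1)]
    have lt: "\<And>x. x \<in> D \<Longrightarrow> x < h" using D(4) that(2) by (meson le_less_trans)
    have pos: "1 \<le> card D" using D by (simp add: Suc_le_eq card_gt_0_iff)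
    have c: "card (insert h D) = Suc (card D)" using D lt by (subst card_insert_disjoint) auto
    note ne = nth_elem_insert_Max[OF D(1) lt]
    have "(\<Prod>u = 1..<Suc (card D). g (nth_elem (insert h D) u) (nth_elem (insert h D) (u + 1)))
        = (\<Prod>u = 1..<card D. g (nth_elem D u) (nth_elem D (u + 1))) * g d h"
      using pos nth_elem_card[OF that(1)]
      by (simp add: prod.atLeastLessThan_Suc ne)
    then show ?thesis unfolding w_def c using pos by (simp add: ne)
  qed
  have inj: "inj_on (insert h) (index_sets (Suc d))" if "d < h" for d
  proof (rule inj_onI)
    fix A B assume "A \<in> index_sets (Suc d)" "B \<in> index_sets (Suc d)" "insert h A = insert h B"
    moreover have "h \<notin> A" "h \<notin> B"
      using calculation(1,2) index_setsD(4) that by (meson not_less)+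
    ultimately show "A = B" by (simp add: insert_ident)
  qed
  have single: "w {h} = N * f h" by (simp add: w_def nth_elem_def)
  have notin: "{h} \<notin> (\<Union>d<h. insert h ` index_sets (Suc d))"
  proof
    assume "{h} \<in> (\<Union>d<h. insert h ` index_sets (Suc d))"
    then obtain d D where "d < h" "D \<in> index_sets (Suc d)" "{h} = insert h D" by auto
    then show False using index_setsD(3)[of D d] by auto
  qed
  have disj: "insert h ` index_sets (Suc d) \<inter> insert h ` index_sets (Suc d') = {}"
    if "d < h" "d' < h" "d \<noteq> d'" for d d'
  proof (rule ccontr)
    assume "\<not> ?thesis"
    then obtain A B where AB: "A \<in> index_sets (Suc d)" "B \<in> index_sets (Suc d')"
      "insert h A = insert h B" by auto
    moreover have "h \<notin> A" "h \<notin> B"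
      using AB index_setsD(4) that by (meson not_less)+
    ultimately have "A = B" by (simp add: insert_ident)
    then show False using AB index_setsD(5) that by metis
  qed
  have "chain_sum N f g (Suc h) = sum w (index_sets (Suc h))"
    by (simp add: chain_sum_def w_def)
  also have "\<dots> = w {h} + sum w (\<Union>d<h. insert h ` index_sets (Suc d))"
    unfolding index_sets_Suc[of h] using notin by (subst sum.insert) (auto simp: finite_index_sets)
  also have "sum w (\<Union>d<h. insert h ` index_sets (Suc d))
      = (\<Sum>d<h. sum w (insert h ` index_sets (Suc d)))"
    using disj by (intro sum.UNION_disjoint) (auto simp: finite_index_sets)
  also have "\<dots> = (\<Sum>d<h. N * (chain_sum N f g (Suc d) * g d h))"
  proof (rule sum.cong)
    fix d assume d: "d \<in> {..<h}"
    then have "sum w (insert h ` index_sets (Suc d)) = (\<Sum>D\<in>index_sets (Suc d). w (insert h D))"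
      by (subst sum.reindex) (auto intro: inj)
    also have "\<dots> = (\<Sum>D\<in>index_sets (Suc d). N * w D * g d h)"
      using d by (intro sum.cong) (auto simp: w_insert)
    also have "\<dots> = N * (chain_sum N f g (Suc d) * g d h)"
      unfolding chain_sum_def w_def[symmetric] by (simp add: sum_distrib_left sum_distrib_right mult_ac)
    finally show "sum w (insert h ` index_sets (Suc d)) = N * (chain_sum N f g (Suc d) * g d h)" .
  qed simp
  finally show ?thesis by (simp add: single sum_distrib_left distrib_left)
qed

section \<open>The coefficients solve the triangular systems\<close>

text \<open>
  With \<open>i = d + 1\<close> one has \<open>\<kappa>\<^sub>r\<^sub>,\<^sub>i = (-1)\<^sup>d / (m - 1 - d)! K\<^sub>i\<close> for the chain sum \<open>K\<close>. The terms with
  \<open>d > h\<close> vanish, the diagonal term is \<open>K\<^bsub>h + 1\<^esub> / N\<close>, and the terms with \<open>d < h\<close> are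
  \<open>- K\<^bsub>d + 1\<^esub> g d h\<close>; the recursion for chain sums cancels the latter.
\<close>

lemma kappa_triangular_system:
  assumes "j \<ge> 1" "a j \<noteq> 0" "r \<in> char_roots j a" "h < root_mult j a r"
  shows "(\<Sum>i = 1..root_mult j a r. kappa j a c r i *
      (\<Sum>k = 0..<j. of_nat k ^ (root_mult j a r - i) * r ^ k * s_coeff j a r k h))
    = (\<Sum>k = 0..<j. c k * s_coeff j a r k h)"
proof -
  define m where "m = root_mult j a r"
  define N where "N = N_coeff j a r"
  define f where "f h = (\<Sum>k = 0..<j. c k * s_coeff j a r k h)" for h
  define T where "T q h = (\<Sum>k = 0..<j. of_nat k ^ q * r ^ k * s_coeff j a r k h)" for q h
  define g where "g d h = - ((- 1) ^ d / fact (m - 1 - d) * T (m - 1 - d) h)" for d h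
  define K where "K = chain_sum N f g"
  have N: "N \<noteq> 0"
    using assms char_root_nonzero cofactor_nonzero_at_inverse by (simp add: N_def N_coeff_eq)
  \<comment> \<open>For \<open>d = 0\<close> the exponent is \<open>-1\<close>, and the sign is still \<open>-1\<close>.\<close>
  have sgn: "(- 1 :: complex) powi (int d - 1) = - ((- 1) ^ d)" for d
    by (simp add: power_int_diff)
  have g: "(\<Sum>k = 0..<j. of_nat k ^ (m - 1 - d) * r ^ k * s_coeff j a r k d' /
      ((- 1) powi (int d - 1) * fact (m - 1 - d))) = g d d'" for d d'
  proof -
    have "((- 1) ^ d)\<^sup>2 = (1 :: complex)" by (simp add: power_even_eq[symmetric] flip: power_mult)
    then have "inverse (- ((- 1) ^ d) * fact (m - 1 - d)) = - ((- 1 :: complex) ^ d / fact (m - 1 - d))"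
      by (simp add: field_simps power2_eq_square)
    then show ?thesis
      unfolding sgn g_def T_def by (simp add: divide_inverse sum_distrib_left mult_ac sum_negf)
  qed
  have kappa: "kappa j a c r (Suc d) = (- 1) ^ d / fact (m - 1 - d) * K (Suc d)" for d
    unfolding kappa_def K_def chain_sum_def m_def[symmetric] N_def[symmetric] f_def[symmetric] g
    by simp
  have hm: "h < m" using assms(4) by (simp add: m_def)
  have "(\<Sum>i = 1..m. kappa j a c r i * T (m - i) h) = (\<Sum>d<m. kappa j a c r (Suc d) * T (m - 1 - d) h)"
    by (rule sum.reindex_bij_witness[of _ Suc "\<lambda>i. i - 1"]) auto
  also have "\<dots> = (\<Sum>d<Suc h. kappa j a c r (Suc d) * T (m - 1 - d) h)"
  proof (rule sum.mono_neutral_right)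
    show "\<forall>d\<in>{..<m} - {..<Suc h}. kappa j a c r (Suc d) * T (m - 1 - d) h = 0"
      using s_functional_same_root(1)[OF assms(1-3) _ assms(4)] hm by (auto simp: T_def m_def)
  qed (use hm in auto)
  also have "\<dots> = - (\<Sum>d<h. K (Suc d) * g d h) + kappa j a c r (Suc h) * T (m - 1 - h) h"
    by (simp add: kappa g_def sum_negf mult_ac)
  also have "T (m - 1 - h) h = (- 1) ^ h * fact (m - 1 - h) * inverse N"
    using s_functional_same_root(2)[OF assms(1-3) _ assms(4), of "m - 1 - h"] hm
    by (simp add: T_def m_def N_def)
  also have "kappa j a c r (Suc h) * ((- 1) ^ h * fact (m - 1 - h) * inverse N) = K (Suc h) / N"
  proof -
    have "(- 1) ^ h * (- 1) ^ h = (1 :: complex)" by (simp flip: power_mult_distrib)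
    then show ?thesis unfolding kappa by (simp add: field_simps)
  qed
  also have "K (Suc h) = N * (f h + (\<Sum>d<h. K (Suc d) * g d h))"
    unfolding K_def by (rule chain_sum_Suc)
  finally show ?thesis using N by (simp add: m_def T_def f_def)
qed

section \<open>Uniqueness and the closed form\<close>

text \<open>
  The substitution \<open>t = r x - 1\<close> undoes the recentering and turns a factor \<open>t\<^sup>m\<close> into \<open>(r x - 1)\<^sup>m\<close>.
\<close>

lemma order_ge_if_low_coeffs_vanish:
  assumes "r \<noteq> 0" "p \<noteq> 0" "\<And>h. h < m \<Longrightarrow> coeff (recenter r p) h = 0"
  shows "m \<le> order (inverse r) p"
proof -
  have "monom 1 m dvd recenter r p" using assms(3) by (simp add: monom_1_dvd_iff')
  then obtain v where v: "recenter r p = [:0, 1:] ^ m * v" by (auto simp: monom_altdef elim: dvdE)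
  have "p = pcompose (recenter r p) [:- 1, r:]"
    using assms(1) by (simp add: pcompose_assoc[symmetric] pcompose_pCons pcompose_idR)
  also have "\<dots> = [:- 1, r:] ^ m * pcompose v [:- 1, r:]"
    unfolding v by (simp add: pcompose_mult pcompose_power pcompose_pCons)
  also have "[:- 1, r:] = smult r [:- inverse r, 1:]" using assms(1) by simp
  finally have "[:- inverse r, 1:] ^ m dvd p"
    by (metis smult_power dvd_smult dvd_refl dvd_mult2)
  then show ?thesis using assms(2) by (simp add: order_divides)
qed

lemma sum_root_mult:
  assumes "j \<ge> 1" "a j \<noteq> 0"
  shows "(\<Sum>r\<in>char_roots j a. root_mult j a r) = j"
proof -
  have "degree (recip_char_poly j a) = (\<Sum>r\<in>char_roots j a. degree ([:1, - r:] ^ root_mult j a r))"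
    unfolding recip_char_poly_factorization[of j a, OF assms]
    by (rule degree_prod_eq_sum_degree) (simp add: power_not_zero)
  also have "\<dots> = (\<Sum>r\<in>char_roots j a. root_mult j a r)"
    using char_root_nonzero[of j a] assms by (intro sum.cong) (auto simp: degree_power_eq)
  finally show ?thesis using degree_recip_char_poly[of j a, OF assms] by simp
qed

text \<open>
  The vanishing functionals force \<open>\<Sum>\<^sub>r m\<^sub>r = j\<close> zeros, counted with multiplicity, on a numerator of
  degree less than \<open>j\<close>. The numerator is then zero, and \<open>Q\<close> can be cancelled from \<open>Q\<close> times the
  generating function.
\<close>

lemma sequence_zero_if_functionals_vanish:
  assumes "j \<ge> 1" "a j \<noteq> 0"
    and "\<And>n. n \<ge> j \<Longrightarrow> fps_nth (fps_of_poly (recip_char_poly j a) * Abs_fps e) n = 0"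
    and "\<And>r h. r \<in> char_roots j a \<Longrightarrow> h < root_mult j a r \<Longrightarrow>
      (\<Sum>k = 0..<j. e k * s_coeff j a r k h) = 0"
  shows "e n = 0"
proof -
  define P where "P = numerator j a e"
  have "P = 0"
  proof (rule ccontr)
    assume P: "P \<noteq> 0"
    have le: "root_mult j a r \<le> order (inverse r) P" if r: "r \<in> char_roots j a" for r
    proof (rule order_ge_if_low_coeffs_vanish[OF _ P])
      show "r \<noteq> 0" using char_root_nonzero[of j a r] assms(1,2) r by simp
      show "coeff (recenter r P) h = 0" if h: "h < root_mult j a r" for h
        using s_functional_eq_coeff[of j a r h e, OF assms(1,2) r h] assms(4)[OF r h]
        by (simp add: P_def)
    qed
    have "j = (\<Sum>r\<in>char_roots j a. root_mult j a r)"
      using sum_root_mult[of j a, OF assms(1,2)] by simp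
    also have "\<dots> \<le> (\<Sum>r\<in>char_roots j a. order (inverse r) P)"
      by (intro sum_mono le)
    also have "\<dots> = (\<Sum>x\<in>inverse ` char_roots j a. order x P)"
      by (subst sum.reindex) (auto simp: inj_on_def)
    also have "\<dots> \<le> (\<Sum>x | poly P x = 0. order x P)"
    proof (rule sum_mono2)
      show "inverse ` char_roots j a \<subseteq> {x. poly P x = 0}"
      proof
        fix x assume "x \<in> inverse ` char_roots j a"
        then obtain r where "r \<in> char_roots j a" "x = inverse r" by auto
        with le[of r] root_mult_pos[of r j a] have "order x P \<noteq> 0" by simp
        then show "x \<in> {x. poly P x = 0}" using P order_root by blast
      qed
    qed (use P in \<open>auto intro: poly_roots_finite\<close>)
    also have "\<dots> \<le> degree P" by (rule sum_order_le_degree[OF P])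
    also have "\<dots> < j" unfolding P_def by (rule degree_numerator[OF assms(1)])
    finally show False by simp
  qed
  then have "fps_of_poly (recip_char_poly j a) * Abs_fps e = 0"
    using assms(3) coeff_numerator[of j a e] by (intro fps_ext) (metis P_def coeff_0 fps_zero_nth not_less)
  then have "Abs_fps e = 0"
    using recip_char_poly_nonzero by simp
  then show ?thesis by (metis fps_nth_Abs_fps fps_zero_nth)
qed

theorem theorem1p1:
  fixes j :: nat and a c :: "nat \<Rightarrow> complex"
  assumes "j \<ge> 1"
    and "a j \<noteq> 0"
    and "\<And>n. n \<ge> j \<Longrightarrow> c n = (\<Sum>l = 1..j. a l * c (n - l))"
  shows "\<forall>n. c n =
    (\<Sum>r \<in> char_roots j a. \<Sum>i = 1..root_mult j a r.
       kappa j a c r i * of_nat n ^ (root_mult j a r - i) * r ^ n)"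
proof
  fix n
  define Q where "Q = fps_of_poly (recip_char_poly j a)"
  define R where "R = char_roots j a"
  define m where "m = root_mult j a"
  define y :: "complex \<Rightarrow> nat \<Rightarrow> nat \<Rightarrow> complex"
    where "y r i n = of_nat n ^ (m r - i) * r ^ n" for r i n
  define e where "e n = c n - (\<Sum>r\<in>R. \<Sum>i = 1..m r. kappa j a c r i * y r i n)" for n
  have Abs_e: "Abs_fps e = Abs_fps c -
      (\<Sum>r\<in>R. \<Sum>i = 1..m r. fps_const (kappa j a c r i) * Abs_fps (y r i))"
    by (rule fps_ext) (simp add: e_def fps_sum_nth)
  have y_rec: "fps_nth (Q * Abs_fps (y r i)) n = 0"
    if "r \<in> R" "i \<in> {1..m r}" "n \<ge> j" for r i n
  proof -
    have "Q * Abs_fps (y r i) = fps_of_poly (numerator j a (y r i))"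
      using basic_solution[of j a r "m r - i", OF assms(1,2)] root_mult_pos[of r j a] that
      unfolding y_def Q_def R_def m_def by auto
    then show ?thesis using that(3) by (simp add: coeff_numerator)
  qed
  have "fps_nth (Q * Abs_fps e) n = 0" if "n \<ge> j" for n
  proof -
    have "fps_nth (Q * Abs_fps e) n = fps_nth (Q * Abs_fps c) n -
        (\<Sum>r\<in>R. \<Sum>i = 1..m r. kappa j a c r i * fps_nth (Q * Abs_fps (y r i)) n)"
      by (simp add: Abs_e right_diff_distrib sum_distrib_left fps_sum_nth mult.left_commute[of Q])
    also have "fps_nth (Q * Abs_fps c) n = 0"
      using assms(3)[OF that] that by (simp add: Q_def recip_char_poly_times_gf min_def)
    also have "(\<Sum>r\<in>R. \<Sum>i = 1..m r. kappa j a c r i * fps_nth (Q * Abs_fps (y r i)) n) = 0"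
      using that by (intro sum.neutral ballI) (simp add: y_rec)
    finally show ?thesis by simp
  qed
  moreover have "(\<Sum>k = 0..<j. e k * s_coeff j a r k h) = 0" if r: "r \<in> R" and h: "h < m r" for r h
  proof -
    define S where "S x = (\<Sum>k = 0..<j. x k * s_coeff j a r k h)" for x
    have "S e = S c -
        (\<Sum>k = 0..<j. \<Sum>r'\<in>R. \<Sum>i = 1..m r'. kappa j a c r' i * y r' i k * s_coeff j a r k h)"
      unfolding S_def e_def
      by (simp only: left_diff_distrib sum_subtractf sum_distrib_right)
    also have "\<dots> = S c - (\<Sum>r'\<in>R. \<Sum>i = 1..m r'. kappa j a c r' i * S (y r' i))"
      unfolding S_def sum_distrib_left mult.assoc[symmetric]
      by (subst sum.swap, subst (2) sum.swap) (rule refl)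
    also have "(\<Sum>r'\<in>R. \<Sum>i = 1..m r'. kappa j a c r' i * S (y r' i))
        = (\<Sum>i = 1..m r. kappa j a c r i * S (y r i))"
    proof (rule sum.remove[THEN trans])
      have "(\<Sum>r'\<in>R - {r}. \<Sum>i = 1..m r'. kappa j a c r' i * S (y r' i)) = 0"
        using s_functional_other_root[of j a r, OF assms(1,2)] r h
        by (intro sum.neutral ballI) (auto simp: S_def y_def R_def m_def)
      then show "(\<Sum>i = 1..m r. kappa j a c r i * S (y r i))
          + (\<Sum>r'\<in>R - {r}. \<Sum>i = 1..m r'. kappa j a c r' i * S (y r' i))
          = (\<Sum>i = 1..m r. kappa j a c r i * S (y r i))" by simp
    qed (use r finite_char_roots in \<open>auto simp: R_def\<close>)
    also have "\<dots> = S c"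
      using kappa_triangular_system[of j a r h c, OF assms(1,2)] r h
      by (simp add: S_def y_def R_def m_def)
    finally show ?thesis by (simp add: S_def)
  qed
  ultimately have "e n = 0"
    using sequence_zero_if_functionals_vanish[of j a e n] assms(1,2)
    unfolding R_def m_def Q_def by blast
  then show "c n = (\<Sum>r \<in> char_roots j a. \<Sum>i = 1..root_mult j a r.
       kappa j a c r i * of_nat n ^ (root_mult j a r - i) * r ^ n)"
    by (simp add: e_def y_def R_def m_def mult.assoc)
qed

end
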